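(* Let $q\in\mathbb{N}^+$, let $\mathbb{T}_q$ be the $(q+1)$-regular tree with root $o$, and let $f:V(\mathbb{T}_q)\to\mathbb{R}$ have finite support and satisfy $f(v_1)=f(v_2)$ whenever $d(v_1,o)=d(v_2,o)$; write $f(n)$ for the value of $f$ at vertices at distance $n$ from $o$. Suppose $h:\mathbb{C}\to\mathbb{C}$ satisfies $h(q^{s-1/2}+q^{-s+1/2})=\hat f(s)$ for all $s\in\mathbb{C}$. Then for all $n\ge0$, $$\mathrm{H}f(n)=a_{n,1}(h)\,q^{-n/2},\qquad f(n)=a_{n,q}(h)\,q^{-n/2}.$$
   Context: Horocycle transform: for $n\in\mathbb{Z}$, $\mathrm{H}f(n)=f(|n|)+(q-1)\sum_{j\ge1}q^{j-1}f(|n|+2j)$. Spherical transform: $\hat f(s)=\sum_{n\in\mathbb{Z}}\mathrm{H}f(n)\,q^{|n|/2}z^n$ with $z=q^{s-1/2}$. For $p\in\{1,q\}$ and $n\in\mathbb{N}$, $a_{n,p}(h)$ is the $n$-th coefficient of the expansion $h=\sum_{n\ge0}a_{n,p}(h)X_{n,p}$, namely $a_{n,p}(h)=\frac{1}{2\pi i}\oint_{|\xi|=1}h(\xi+\xi^{-1})\xi^{n-1}\frac{1-\xi^2}{1-p^{-1}\xi^2}d\xi$, where the polynomials $X_{n,p}$ are defined by $\frac{1-p^{-1}t^2}{1-xt+t^2}=\sum_{n\ge0}X_{n,p}(x)t^n$.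
   Formalization: For q=1 the condition on h only fixes h(2) and the claim fails (f=0, h(x)=x-2); in that case the formal statement also assumes that h(z+1/z) equals the sum over n in Z of Hf(n) q^{|n|/2} z^n for all nonzero complex z. Nothing is added for q at least 2. *)

theory Defs
  imports "HOL-Complex_Analysis.Complex_Analysis"
begin

text \<open>A simple undirected graph is a vertex set together with a symmetric irreflexive edge
  relation. A cycle is listed without repeating its first vertex; requiring length at least 3
  excludes traversing a single edge back and forth.\<close>

definition is_cycle :: "'v rel \<Rightarrow> 'v list \<Rightarrow> bool" where
  "is_cycle E xs \<longleftrightarrow>
     length xs \<ge> 3 \<and> distinct xs \<and> successively (\<lambda>u v. (u, v) \<in> E) xs \<and> (last xs, hd xs) \<in> E"

text \<open>For \<open>d > 0\<close> the degree condition includes local finiteness, since infinite sets have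
  cardinality 0.\<close>

locale regular_tree =
  fixes V :: "'v set" and E :: "'v rel" and d :: nat
  assumes edges_subset: "E \<subseteq> V \<times> V"
    and sym_edges: "sym E"
    and irrefl_edges: "irrefl E"
    and connected: "\<And>u v. u \<in> V \<Longrightarrow> v \<in> V \<Longrightarrow> (u, v) \<in> E\<^sup>*"
    and no_cycle: "\<And>xs. \<not> is_cycle E xs"
    and degree: "\<And>v. v \<in> V \<Longrightarrow> card (E `` {v}) = d"

definition graph_dist :: "'v rel \<Rightarrow> 'v \<Rightarrow> 'v \<Rightarrow> nat" where
  "graph_dist E u v = (LEAST n. (u, v) \<in> E ^^ n)"

text \<open>The common value of \<open>f\<close> on the sphere of radius \<open>n\<close> about \<open>v0\<close>, for \<open>f\<close> constant on spheres.\<close>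

definition radial_part :: "'v set \<Rightarrow> 'v rel \<Rightarrow> 'v \<Rightarrow> ('v \<Rightarrow> real) \<Rightarrow> nat \<Rightarrow> real" where
  "radial_part V E v0 f n = the_elem (f ` {v \<in> V. graph_dist E v v0 = n})"

definition horocycle :: "nat \<Rightarrow> (nat \<Rightarrow> real) \<Rightarrow> int \<Rightarrow> real" where
  "horocycle q \<phi> n =
     \<phi> (nat \<bar>n\<bar>) + (real q - 1) * (\<Sum>\<^sub>\<infinity>j\<in>{1..}. real q ^ (j - 1) * \<phi> (nat \<bar>n\<bar> + 2 * j))"

definition spherical_series :: "nat \<Rightarrow> (nat \<Rightarrow> real) \<Rightarrow> complex \<Rightarrow> complex" where
  "spherical_series q \<phi> z =
     (\<Sum>\<^sub>\<infinity>n\<in>(UNIV :: int set).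
        of_real (horocycle q \<phi> n * real q powr (of_int \<bar>n\<bar> / 2)) * z powi n)"

definition spherical_transform :: "nat \<Rightarrow> (nat \<Rightarrow> real) \<Rightarrow> complex \<Rightarrow> complex" where
  "spherical_transform q \<phi> s = spherical_series q \<phi> (of_nat q powr (s - 1/2))"

text \<open>The coefficient of \<open>X\<^sub>n\<^sub>,\<^sub>p\<close> in the expansion of \<open>h\<close>, where
  \<open>(1 - t\<^sup>2/p) / (1 - x t + t\<^sup>2) = (\<Sum>n. X\<^sub>n\<^sub>,\<^sub>p(x) t\<^sup>n)\<close>, given by its integral formula. For
  \<open>p = 1\<close> the last factor is 1 except at \<open>\<xi> = \<plusminus>1\<close>, where division by zero makes it 0; two points do
  not affect the integral.\<close>

definition X_coeff :: "nat \<Rightarrow> nat \<Rightarrow> (complex \<Rightarrow> complex) \<Rightarrow> complex" where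
  "X_coeff n p h =
     1 / (2 * of_real pi * \<i>) *
     contour_integral (circlepath 0 1)
       (\<lambda>\<xi>. h (\<xi> + inverse \<xi>) * \<xi> powi (int n - 1) * ((1 - \<xi>\<^sup>2) / (1 - inverse (of_nat p) * \<xi>\<^sup>2)))"

end

theory Submission
  imports Defs
begin

text \<open>On the unit circle \<open>h (\<xi> + 1/\<xi>)\<close> is the Laurent polynomial with coefficients
  \<open>c\<^sub>k = Hf(k) q\<^bsup>|k|/2\<^esup>\<close>. For \<open>p = 1\<close> the integral picks out \<open>c\<^sub>n\<close>. For \<open>p = q \<ge> 2\<close>, clearing the
  denominator gives \<open>a\<^sub>n - a\<^bsub>n+2\<^esub> / q = c\<^sub>n - c\<^bsub>n+2\<^esub>\<close>. The numbers \<open>f(n) q\<^bsup>n/2\<^esup>\<close> satisfy the same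
  recurrence, because \<open>Hf(n) - q Hf(n+2) = f(n) - f(n+2)\<close>, and both sequences vanish for large \<open>n\<close>,
  hence agree. That \<open>f(n)\<close> is meaningful and eventually zero requires all spheres of the tree to be
  nonempty; otherwise the tree would be finite, and a longest path in it would close up to a cycle.\<close>

section \<open>Spheres in a regular tree\<close>

text \<open>In a longest path the first vertex has a neighbour other than the second vertex. By
  maximality that neighbour lies on the path, and the initial segment ending there closes
  up.\<close>

lemma finite_min_degree_2_imp_cycle:
  fixes V :: "'v set"
  assumes "finite V" "V \<noteq> {}" "E \<subseteq> V \<times> V" "sym E" "irrefl E"
    and deg: "\<And>v. v \<in> V \<Longrightarrow> card (E `` {v}) \<ge> 2"
  shows "\<exists>xs. is_cycle E xs"
proof -
  define P where "P = (\<lambda>xs. xs \<noteq> [] \<and> distinct xs \<and> set xs \<subseteq> V \<and> successively (\<lambda>u v. (u, v) \<in> E) xs)"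
  obtain v where "v \<in> V" using assms(2) by blast
  then have "P [v]" by (simp add: P_def)
  moreover have "length xs < Suc (card V)" if "P xs" for xs
    using that assms(1) by (metis P_def card_mono distinct_card le_imp_less_Suc)
  ultimately obtain xs where xs: "P xs" and longest: "\<And>ys. P ys \<Longrightarrow> length ys \<le> length xs"
    using ex_has_greatest_nat[of P "[v]" length "Suc (card V)"] by auto
  obtain x ys where xs_eq: "xs = x # ys" using xs by (cases xs) (auto simp: P_def)
  have "x \<in> V" using xs by (simp add: P_def xs_eq)
  \<comment> \<open>If \<open>ys\<close> is empty, \<open>hd ys\<close> is an unspecified element;
    two neighbours still cannot fit into a singleton.\<close>
  have "\<not> E `` {x} \<subseteq> {hd ys}"
    using deg[OF \<open>x \<in> V\<close>] card_mono[of "{hd ys}" "E `` {x}"] by auto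
  then obtain w where w: "(x, w) \<in> E" "w \<noteq> hd ys" by auto
  have wx: "(w, x) \<in> E" using w assms(4) by (auto dest: symD)
  have "w \<in> set xs"
  proof (rule ccontr)
    assume "w \<notin> set xs"
    then have "P (w # xs)"
      using xs wx assms(3) by (auto simp: P_def xs_eq successively_Cons)
    from longest[OF this] show False by simp
  qed
  then obtain as bs where split: "xs = as @ w # bs" by (meson split_list)
  have "w \<noteq> x" using w assms(5) by (auto simp: irrefl_def)
  then obtain as' where as: "as = x # as'" using split xs_eq by (cases as) auto
  then have "as' \<noteq> []" using split xs_eq w by auto
  then have "length (as @ [w]) \<ge> 3" using as by (cases as') auto
  moreover have "distinct (as @ [w])" "successively (\<lambda>u v. (u, v) \<in> E) (as @ [w])"
    using xs unfolding P_def split by (auto simp: successively_append_iff)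
  ultimately have "is_cycle E (as @ [w])"
    using wx as by (simp add: is_cycle_def)
  then show ?thesis by blast
qed

lemma graph_dist_le: "(u, v) \<in> E ^^ n \<Longrightarrow> graph_dist E u v \<le> n"
  unfolding graph_dist_def by (rule Least_le)

context regular_tree
begin

lemma graph_dist_relpow:
  assumes "u \<in> V" "v \<in> V"
  shows "(u, v) \<in> E ^^ graph_dist E u v"
  using connected[OF assms] unfolding graph_dist_def by (metis LeastI rtrancl_power)

text \<open>The first step of a shortest walk to \<open>v0\<close> lowers the distance by exactly
  one, so every smaller distance also occurs.\<close>

lemma ex_graph_dist_eq:
  assumes "v0 \<in> V"
  shows "v \<in> V \<Longrightarrow> graph_dist E v v0 = n + k \<Longrightarrow> \<exists>w\<in>V. graph_dist E w v0 = n"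
proof (induction k arbitrary: v)
  case (Suc k)
  then have "(v, v0) \<in> E ^^ Suc (n + k)"
    using graph_dist_relpow[OF Suc.prems(1) assms] by simp
  then obtain w where w: "(v, w) \<in> E" "(w, v0) \<in> E ^^ (n + k)"
    by (meson relpow_Suc_D2)
  have "w \<in> V" using w edges_subset by auto
  \<comment> \<open>Going through \<open>w\<close> bounds the distance of \<open>v\<close> from
    above, so \<open>w\<close> cannot be closer than \<open>n + k\<close>.\<close>
  have "(v, v0) \<in> E ^^ Suc (graph_dist E w v0)"
    using w(1) graph_dist_relpow[OF \<open>w \<in> V\<close> assms] by (rule relpow_Suc_I2)
  then have "graph_dist E w v0 = n + k"
    using graph_dist_le[OF w(2)] graph_dist_le[of v v0 "Suc (graph_dist E w v0)" E] Suc.prems(2) by simp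
  then show ?case using Suc.IH \<open>w \<in> V\<close> by blast
qed auto

text \<open>A positive \<open>card\<close> forces each neighbourhood of a vertex to be finite, and
  finiteness then propagates one step at a time.\<close>

lemma finite_relpow_to:
  assumes "d > 0"
  shows "finite {v. (v, v0) \<in> E ^^ n}"
proof (induction n)
  case (Suc n)
  have fin: "finite (E `` {w})" for w
    using assms degree[of w] edges_subset by (cases "w \<in> V") (auto intro: card_ge_0_finite finite_subset[of _ "{}"])
  have "{v. (v, v0) \<in> E ^^ Suc n} \<subseteq> (\<Union>w\<in>{w. (w, v0) \<in> E ^^ n}. E `` {w})"
    using sym_edges by (auto dest!: relpow_Suc_D2 dest: symD simp del: relpow.simps)
  then show ?case using Suc fin by (meson finite_UN_I finite_subset)
qed auto

lemma sphere_nonempty: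
  assumes "v0 \<in> V" "d \<ge> 2"
  shows "\<exists>v\<in>V. graph_dist E v v0 = n"
proof (rule ccontr)
  assume *: "\<not> ?thesis"
  have "V \<subseteq> (\<Union>m<n. {v. (v, v0) \<in> E ^^ m})"
  proof
    fix v assume "v \<in> V"
    then have "graph_dist E v v0 < n"
      using * ex_graph_dist_eq[OF assms(1), of v n "graph_dist E v v0 - n"]
      by (metis le_add_diff_inverse not_le)
    then show "v \<in> (\<Union>m<n. {v. (v, v0) \<in> E ^^ m})"
      using graph_dist_relpow[OF \<open>v \<in> V\<close> assms(1)] by blast
  qed
  then have "finite V" using finite_relpow_to assms(2)
    by (meson finite_UN_I finite_lessThan finite_subset less_le_trans pos2)
  then show False
    using finite_min_degree_2_imp_cycle[of V E] assms edges_subset sym_edges irrefl_edges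
      degree no_cycle by auto
qed

text \<open>Beyond the support \<open>f\<close> is zero on each sphere, and nonemptiness makes its
  image there exactly the singleton of 0, as \<open>the_elem\<close> requires.\<close>

lemma radial_part_eventually_0:
  assumes "v0 \<in> V" "d \<ge> 2" and fin: "finite {v \<in> V. f v \<noteq> 0}"
  obtains N where "\<And>n. n > N \<Longrightarrow> radial_part V E v0 f n = 0"
proof
  \<comment> \<open>Inserting 0 keeps \<open>Max\<close> meaningful when \<open>f\<close> vanishes
    on \<open>V\<close>.\<close>
  define N where "N = Max (insert 0 ((\<lambda>v. graph_dist E v v0) ` {v \<in> V. f v \<noteq> 0}))"
  fix n assume "n > N"
  have "f v = 0" if "v \<in> V" "graph_dist E v v0 = n" for v
  proof (rule ccontr)
    assume "f v \<noteq> 0"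
    then have "n \<le> N" unfolding N_def using that fin by (intro Max_ge) auto
    then show False using \<open>n > N\<close> by simp
  qed
  then have "f ` {v \<in> V. graph_dist E v v0 = n} = {0}"
    using sphere_nonempty[OF assms(1,2), of n] by auto
  then show "radial_part V E v0 f n = 0"
    by (simp add: radial_part_def)
qed

end

section \<open>The horocycle transform\<close>

text \<open>Splitting off the term \<open>j = 1\<close> and shifting the index expresses the tail
  sum at \<open>n\<close> as \<open>\<phi> (n + 2)\<close> plus \<open>q\<close> times the tail sum
  at \<open>n + 2\<close>.\<close>

lemma horocycle_diff:
  assumes "\<And>n. n > N \<Longrightarrow> \<phi> n = 0"
  shows "horocycle q \<phi> (int n) - real q * horocycle q \<phi> (int n + 2) = \<phi> n - \<phi> (n + 2)"
proof -
  define g where "g = (\<lambda>n j. real q ^ (j - 1) * \<phi> (n + 2 * j))"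
  have summable: "g n summable_on A" for n A
  proof (rule finite_nonzero_values_imp_summable_on)
    have "g n x = 0" if "x > N" for x
      using assms[of "n + 2 * x"] that by (simp add: g_def)
    then have "{x \<in> A. g n x \<noteq> 0} \<subseteq> {..N}"
      by (auto simp: not_less[symmetric])
    then show "finite {x \<in> A. g n x \<noteq> 0}" by (rule finite_subset) simp
  qed
  have ins: "{1::nat..} = insert 1 (Suc ` {1..})"
  proof (intro equalityI subsetI)
    fix x :: nat assume "x \<in> {1..}"
    then show "x \<in> insert 1 (Suc ` {1..})" by (cases x) auto
  qed auto
  have "infsum (g n) {1..} = g n 1 + infsum (g n) (Suc ` {1..})"
    using infsum_insert[OF summable, of 1 "Suc ` {1..}" n] ins by auto
  also have "infsum (g n) (Suc ` {1..}) = infsum (g n \<circ> Suc) {1..}"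
    by (rule infsum_reindex) auto
  \<comment> \<open>The range \<open>j \<ge> 1\<close> matters here: at \<open>j = 0\<close> the
    truncated exponent \<open>j - 1\<close> would break the identity.\<close>
  also have "\<dots> = infsum (\<lambda>j. real q * g (n + 2) j) {1..}"
    by (rule infsum_cong) (auto simp: g_def Suc_le_eq power_eq_if)
  also have "\<dots> = real q * infsum (g (n + 2)) {1..}"
    by (rule infsum_cmult_right')
  finally have rec: "infsum (g n) {1..} = \<phi> (n + 2) + real q * infsum (g (n + 2)) {1..}"
    by (simp add: g_def)
  have "nat (int n + 2) = n + 2" by simp
  then have H: "horocycle q \<phi> (int n) = \<phi> n + (real q - 1) * infsum (g n) {1..}"
    "horocycle q \<phi> (int n + 2) = \<phi> (n + 2) + (real q - 1) * infsum (g (n + 2)) {1..}"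
    by (simp_all add: horocycle_def g_def)
  show ?thesis unfolding H rec by (simp add: algebra_simps)
qed

lemma horocycle_eq_0:
  assumes "\<And>n. n > N \<Longrightarrow> \<phi> n = 0" "\<bar>n\<bar> > int N"
  shows "horocycle q \<phi> n = 0"
proof -
  have "\<phi> (nat \<bar>n\<bar>) = 0" "\<And>j. \<phi> (nat \<bar>n\<bar> + 2 * j) = 0"
    using assms by auto
  then show ?thesis by (simp add: horocycle_def)
qed

lemma spherical_series_finite:
  assumes "\<And>n. n > N \<Longrightarrow> \<phi> n = 0"
  shows "spherical_series q \<phi> z = (\<Sum>k\<in>{-int N..int N}.
    of_real (horocycle q \<phi> k * real q powr (of_int \<bar>k\<bar> / 2)) * z powi k)"
proof -
  have "spherical_series q \<phi> z = (\<Sum>\<^sub>\<infinity>k\<in>{-int N..int N}.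
    of_real (horocycle q \<phi> k * real q powr (of_int \<bar>k\<bar> / 2)) * z powi k)"
    unfolding spherical_series_def
    by (rule infsum_cong_neutral) (auto simp: horocycle_eq_0[OF assms])
  then show ?thesis by simp
qed

section \<open>Laurent polynomials on the unit circle\<close>

text \<open>Every power except the exponent -1 has a primitive on the punctured plane.\<close>

lemma has_contour_integral_powi_circlepath:
  "((\<lambda>\<xi>. \<xi> powi m) has_contour_integral (if m = -1 then 2 * of_real pi * \<i> else 0))
     (circlepath 0 1)"
proof (cases "m = -1")
  case True
  have "((\<lambda>\<xi>. 1 / (\<xi> - 0)) has_contour_integral 2 * of_real pi * \<i>) (circlepath 0 1)"
    unfolding contour_integral_circlepath[OF zero_less_one, of 0, symmetric]
    by (intro has_contour_integral_integral contour_integrable_continuous_circlepath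
        continuous_intros) auto
  then have "((\<lambda>\<xi>. \<xi> powi m) has_contour_integral 2 * of_real pi * \<i>) (circlepath 0 1)"
    by (rule has_contour_integral_eq) (simp add: True inverse_eq_divide)
  then show ?thesis using True by simp
next
  case False
  have "((\<lambda>\<xi>. \<xi> powi m) has_contour_integral 0) (circlepath 0 1)"
  proof (rule Cauchy_theorem_primitive[where S = "-{0}"])
    fix x :: complex assume "x \<in> -{0}"
    moreover have "(of_int (m + 1) :: complex) \<noteq> 0" using False by (simp only: of_int_eq_0_iff)
    ultimately show "((\<lambda>\<xi>. \<xi> powi (m + 1) / of_int (m + 1)) has_field_derivative x powi m)
        (at x within -{0})"
      by (auto intro!: derivative_eq_intros)
  qed auto
  then show ?thesis using False by simp
qed

text \<open>Only the term with \<open>k + m = -1\<close> survives, so multiplying by a power and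
  integrating extracts a single coefficient.\<close>

lemma has_contour_integral_Laurent_polynomial:
  fixes c :: "int \<Rightarrow> complex"
  assumes "finite K"
  shows "((\<lambda>\<xi>. (\<Sum>k\<in>K. c k * \<xi> powi k) * \<xi> powi m) has_contour_integral
    (if -1 - m \<in> K then 2 * of_real pi * \<i> * c (-1 - m) else 0)) (circlepath 0 1)"
proof -
  have "((\<lambda>\<xi>. \<Sum>k\<in>K. c k * \<xi> powi (k + m)) has_contour_integral
      (\<Sum>k\<in>K. c k * (if k + m = -1 then 2 * of_real pi * \<i> else 0))) (circlepath 0 1)"
    by (intro has_contour_integral_sum assms has_contour_integral_lmul
        has_contour_integral_powi_circlepath)
  moreover have "(\<Sum>k\<in>K. c k * (if k + m = -1 then 2 * of_real pi * \<i> else 0)) =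
      (\<Sum>k\<in>K. if -1 - m = k then 2 * of_real pi * \<i> * c k else 0)"
    by (rule sum.cong) auto
  moreover have "\<dots> = (if -1 - m \<in> K then 2 * of_real pi * \<i> * c (-1 - m) else 0)"
    using assms by simp
  ultimately have "((\<lambda>\<xi>. \<Sum>k\<in>K. c k * \<xi> powi (k + m)) has_contour_integral
      (if -1 - m \<in> K then 2 * of_real pi * \<i> * c (-1 - m) else 0)) (circlepath 0 1)"
    by simp
  then show ?thesis
  proof (rule has_contour_integral_eq)
    fix \<xi> :: complex assume "\<xi> \<in> path_image (circlepath 0 1)"
    then have "\<xi> \<noteq> 0" by auto
    then show "(\<Sum>k\<in>K. c k * \<xi> powi (k + m)) = (\<Sum>k\<in>K. c k * \<xi> powi k) * \<xi> powi m"
      by (simp add: sum_distrib_right power_int_add mult.assoc)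
  qed
qed

section \<open>Integral coefficients of an even Laurent polynomial\<close>

locale Laurent_polynomial_on_circle =
  fixes h :: "complex \<Rightarrow> complex" and c :: "int \<Rightarrow> complex" and N :: nat
  assumes h_eq: "\<And>\<xi>. norm \<xi> = 1 \<Longrightarrow> h (\<xi> + inverse \<xi>) = (\<Sum>k\<in>{-int N..int N}. c k * \<xi> powi k)"
    and c_even: "\<And>k. c (-k) = c k"
    and c_eq_0: "\<And>k. \<bar>k\<bar> > int N \<Longrightarrow> c k = 0"
begin

lemma has_contour_integral_h:
  assumes "n \<ge> 0"
  shows "((\<lambda>\<xi>. h (\<xi> + inverse \<xi>) * \<xi> powi (n - 1)) has_contour_integral
    2 * of_real pi * \<i> * c n) (circlepath 0 1)"
proof -
  \<comment> \<open>The integral extracts the coefficient at \<open>-n\<close>, which evenness moves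
    to \<open>n\<close>; outside the range both sides are 0.\<close>
  have "(if - n \<in> {-int N..int N} then 2 * of_real pi * \<i> * c (-n) else 0) =
      2 * of_real pi * \<i> * c n"
    using assms c_even[of n] c_eq_0[of n] by auto
  moreover have "-1 - (n - 1) = -n" by simp
  moreover note has_contour_integral_Laurent_polynomial[of "{-int N..int N}" c "n - 1"]
  ultimately have "((\<lambda>\<xi>. (\<Sum>k\<in>{-int N..int N}. c k * \<xi> powi k) * \<xi> powi (n - 1))
      has_contour_integral 2 * of_real pi * \<i> * c n) (circlepath 0 1)"
    by (simp only: finite_atLeastAtMost_int simp_thms)
  then show ?thesis by (rule has_contour_integral_eq) (simp add: h_eq)
qed

lemma X_coeff_1: "X_coeff n 1 h = c (int n)"
proof -
  have "contour_integral (circlepath 0 1)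
      (\<lambda>\<xi>. h (\<xi> + inverse \<xi>) * \<xi> powi (int n - 1) * ((1 - \<xi>\<^sup>2) / (1 - inverse (of_nat 1) * \<xi>\<^sup>2))) =
    contour_integral (circlepath 0 1) (\<lambda>\<xi>. h (\<xi> + inverse \<xi>) * \<xi> powi (int n - 1))"
    by (rule contour_integral_spike_finite_simple_path[where A = "{1, -1}"])
      (auto simp: simple_path_circlepath power2_eq_1_iff)
  also have "\<dots> = 2 * of_real pi * \<i> * c (int n)"
    by (intro contour_integral_unique has_contour_integral_h) simp
  finally show ?thesis by (simp add: X_coeff_def)
qed

context
  fixes p :: nat
  assumes p: "p \<ge> 2"
begin

text \<open>The zeros have modulus \<open>sqrt p\<close>. For \<open>p \<ge> 2\<close> the closed
  unit disc avoids them, which gives continuity on the circle and holomorphy on a larger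
  disc.\<close>

lemma denominator_nonzero:
  assumes "norm \<xi> < sqrt p"
  shows "1 - inverse (of_nat p) * \<xi>\<^sup>2 \<noteq> (0::complex)"
proof
  assume "1 - inverse (of_nat p) * \<xi>\<^sup>2 = 0"
  then have "\<xi>\<^sup>2 = of_nat p" using p by (simp add: field_simps)
  then have "norm \<xi> ^ 2 = real p" by (metis norm_of_nat norm_power)
  moreover have "norm \<xi> ^ 2 < sqrt p ^ 2"
    using assms by (intro power_strict_mono) auto
  ultimately show False by simp
qed

lemma norm_1_less: "norm (\<xi> :: complex) = 1 \<Longrightarrow> norm \<xi> < sqrt p"
  using p by simp

lemma X_coeff_integrable:
  "(\<lambda>\<xi>. h (\<xi> + inverse \<xi>) * \<xi> powi m * ((1 - \<xi>\<^sup>2) / (1 - inverse (of_nat p) * \<xi>\<^sup>2)))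
     contour_integrable_on circlepath 0 1"
proof (rule contour_integrable_continuous_circlepath)
  have "continuous_on (sphere 0 1)
    (\<lambda>\<xi>. (\<Sum>k\<in>{-int N..int N}. c k * \<xi> powi k) * \<xi> powi m *
      ((1 - \<xi>\<^sup>2) / (1 - inverse (of_nat p) * \<xi>\<^sup>2)))"
    using denominator_nonzero[OF norm_1_less] by (intro continuous_intros) auto
  then show "continuous_on (path_image (circlepath 0 1))
    (\<lambda>\<xi>. h (\<xi> + inverse \<xi>) * \<xi> powi m * ((1 - \<xi>\<^sup>2) / (1 - inverse (of_nat p) * \<xi>\<^sup>2)))"
    by (rule continuous_on_cong[THEN iffD1, rotated 2]) (simp_all add: h_eq)
qed

text \<open>Subtracting \<open>1/p\<close> times the integrand for \<open>n + 2\<close> from that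
  for \<open>n\<close> produces the factor \<open>1 - \<xi>\<^sup>2 / p\<close>, which cancels the
  denominator. What remains is a difference of two plain coefficient integrals.\<close>

lemma X_coeff_diff:
  "X_coeff n p h - X_coeff (n + 2) p h / of_nat p = c (int n) - c (int n + 2)"
proof -
  \<comment> \<open>The index of \<open>G\<close> is the power of \<open>\<xi>\<close>, hence one
    less than the index of the coefficient.\<close>
  define G where "G = (\<lambda>m \<xi>. h (\<xi> + inverse \<xi>) * \<xi> powi m *
    ((1 - \<xi>\<^sup>2) / (1 - inverse (of_nat p) * \<xi>\<^sup>2)))"
  have "((\<lambda>\<xi>. G (int n - 1) \<xi> - inverse (of_nat p) * G (int n + 1) \<xi>) has_contour_integral
      contour_integral (circlepath 0 1) (G (int n - 1)) -
      inverse (of_nat p) * contour_integral (circlepath 0 1) (G (int n + 1))) (circlepath 0 1)"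
    unfolding G_def
    by (intro has_contour_integral_diff has_contour_integral_lmul has_contour_integral_integral
        X_coeff_integrable)
  moreover have "G (int n - 1) \<xi> - inverse (of_nat p) * G (int n + 1) \<xi> =
      h (\<xi> + inverse \<xi>) * \<xi> powi (int n - 1) - h (\<xi> + inverse \<xi>) * \<xi> powi (int n + 2 - 1)"
    if "norm \<xi> = 1" for \<xi>
  proof -
    have "\<xi> \<noteq> 0" using that by auto
    then have powi: "\<xi> powi (int n + 1) = \<xi> powi (int n - 1) * \<xi>\<^sup>2"
      by (simp add: power_int_add power_int_diff power2_eq_square)
    have cancel: "a * (b / d) - e * (a * t * (b / d)) = a * b"
      if "1 - e * t = d" "d \<noteq> 0" for a b d e t :: complex
    proof -
      have "a * (b / d) - e * (a * t * (b / d)) = a * b * (1 - e * t) / d"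
        by (simp add: diff_divide_distrib right_diff_distrib mult_ac)
      then show ?thesis using that by simp
    qed
    have "G (int n - 1) \<xi> - inverse (of_nat p) * G (int n + 1) \<xi> =
        h (\<xi> + inverse \<xi>) * \<xi> powi (int n - 1) * (1 - \<xi>\<^sup>2)"
      unfolding G_def powi mult.assoc[symmetric, of _ _ "\<xi>\<^sup>2"]
      by (rule cancel[OF refl denominator_nonzero[OF norm_1_less[OF that]]])
    moreover have "\<xi> powi (int n + 2 - 1) = \<xi> powi (int n - 1) * \<xi>\<^sup>2"
      using powi by (simp add: add.commute)
    ultimately show ?thesis by (simp add: algebra_simps)
  qed
  ultimately have "((\<lambda>\<xi>. h (\<xi> + inverse \<xi>) * \<xi> powi (int n - 1) -
      h (\<xi> + inverse \<xi>) * \<xi> powi (int n + 2 - 1)) has_contour_integral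
      contour_integral (circlepath 0 1) (G (int n - 1)) -
      inverse (of_nat p) * contour_integral (circlepath 0 1) (G (int n + 1))) (circlepath 0 1)"
    by (rule has_contour_integral_eq) auto
  moreover have "((\<lambda>\<xi>. h (\<xi> + inverse \<xi>) * \<xi> powi (int n - 1) -
      h (\<xi> + inverse \<xi>) * \<xi> powi (int n + 2 - 1)) has_contour_integral
      2 * of_real pi * \<i> * c (int n) - 2 * of_real pi * \<i> * c (int n + 2)) (circlepath 0 1)"
    by (intro has_contour_integral_diff has_contour_integral_h) auto
  ultimately have "contour_integral (circlepath 0 1) (G (int n - 1)) -
      inverse (of_nat p) * contour_integral (circlepath 0 1) (G (int n + 1)) =
      2 * of_real pi * \<i> * c (int n) - 2 * of_real pi * \<i> * c (int n + 2)"
    by (rule has_contour_integral_unique)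
  moreover have
    "contour_integral (circlepath 0 1) (G (int n - 1)) = 2 * of_real pi * \<i> * X_coeff n p h"
    "contour_integral (circlepath 0 1) (G (int n + 1)) = 2 * of_real pi * \<i> * X_coeff (n + 2) p h"
    by (simp_all add: X_coeff_def G_def add.commute)
  ultimately have "2 * of_real pi * \<i> * (X_coeff n p h - X_coeff (n + 2) p h / of_nat p) =
      2 * of_real pi * \<i> * (c (int n) - c (int n + 2))"
    by (simp only: right_diff_distrib divide_inverse mult_ac)
  then show ?thesis by simp
qed

text \<open>For \<open>n > N\<close> all exponents \<open>k + n - 1\<close> with
  \<open>k \<ge> -N\<close> are nonnegative, so Cauchy's theorem applies on the disc of radius
  \<open>sqrt p > 1\<close>. This starts the backward recurrence.\<close>

lemma X_coeff_eq_0: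
  assumes "n > N"
  shows "X_coeff n p h = 0"
proof -
  let ?F = "\<lambda>\<xi>. (\<Sum>k\<in>{-int N..int N}. c k * \<xi> powi (k + (int n - 1))) *
    ((1 - \<xi>\<^sup>2) / (1 - inverse (of_nat p) * \<xi>\<^sup>2))"
  have "(?F has_contour_integral 0) (circlepath 0 1)"
  proof (rule Cauchy_theorem_convex_simple[where S = "ball 0 (sqrt p)"])
    show "?F holomorphic_on ball 0 (sqrt p)"
      using assms denominator_nonzero by (intro holomorphic_intros) auto
  qed (use p in \<open>auto simp: dist_norm\<close>)
  then have "((\<lambda>\<xi>. h (\<xi> + inverse \<xi>) * \<xi> powi (int n - 1) *
      ((1 - \<xi>\<^sup>2) / (1 - inverse (of_nat p) * \<xi>\<^sup>2))) has_contour_integral 0) (circlepath 0 1)"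
  proof (rule has_contour_integral_eq)
    fix \<xi> :: complex assume "\<xi> \<in> path_image (circlepath 0 1)"
    then have "norm \<xi> = 1" "\<xi> \<noteq> 0" by auto
    then show "?F \<xi> = h (\<xi> + inverse \<xi>) * \<xi> powi (int n - 1) *
      ((1 - \<xi>\<^sup>2) / (1 - inverse (of_nat p) * \<xi>\<^sup>2))"
      by (subst h_eq) (simp_all add: power_int_add sum_distrib_right mult.assoc)
  qed
  then show ?thesis by (simp add: X_coeff_def contour_integral_unique)
qed

end

end

section \<open>Inversion by backward recurrence\<close>

lemma backward_recurrence_eq_0:
  fixes D :: "nat \<Rightarrow> 'a::zero"
  assumes "\<And>n. n > N \<Longrightarrow> D n = 0" "\<And>n. D (n + k) = 0 \<Longrightarrow> D n = 0" "k > 0"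
  shows "D n = 0"
proof (induction "N + 1 - n" arbitrary: n rule: less_induct)
  case less
  show ?case
  proof (cases "n > N")
    case False
    \<comment> \<open>The truncated difference drops strictly because \<open>n \<le> N\<close> in
      this case.\<close>
    then have "N + 1 - (n + k) < N + 1 - n" using assms(3) by auto
    then show ?thesis using less assms(2) by blast
  qed (use assms(1) in blast)
qed

text \<open>The result without the tree: only an eventually zero sequence of radial values enters,
  and the relation for \<open>h\<close> is stated directly in the variable \<open>z\<close>.\<close>

lemma inversion_formula:
  fixes q N :: nat and \<phi> :: "nat \<Rightarrow> real"
  assumes q: "q \<ge> 1" and \<phi>_eq_0: "\<And>n. n > N \<Longrightarrow> \<phi> n = 0"
    and h: "\<And>z. z \<noteq> 0 \<Longrightarrow> h (z + inverse z) = spherical_series q \<phi> z"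
  shows "of_real (horocycle q \<phi> (int n)) = X_coeff n 1 h * of_real (real q powr (- real n / 2))"
    and "of_real (\<phi> n) = X_coeff n q h * of_real (real q powr (- real n / 2))"
proof -
  define c where "c = (\<lambda>k. complex_of_real (horocycle q \<phi> k * real q powr (of_int \<bar>k\<bar> / 2)))"
  interpret Laurent_polynomial_on_circle h c N
  proof
    fix \<xi> :: complex assume "norm \<xi> = 1"
    then have "\<xi> \<noteq> 0" by auto
    then show "h (\<xi> + inverse \<xi>) = (\<Sum>k\<in>{-int N..int N}. c k * \<xi> powi k)"
      using h[of \<xi>] spherical_series_finite[of N \<phi> q \<xi>] \<phi>_eq_0 by (simp add: c_def)
    next
    show "c k = 0" if "\<bar>k\<bar> > int N" for k
      using horocycle_eq_0[of N \<phi> k q] \<phi>_eq_0 that by (simp add: c_def)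
  qed (simp add: c_def horocycle_def)
  have cancel: "of_real (x * real q powr (real n / 2)) * of_real (real q powr (- real n / 2)) =
      complex_of_real x" for x
    using q by (simp flip: of_real_mult add: mult.assoc flip: powr_add)
  show H: "of_real (horocycle q \<phi> (int n)) = X_coeff n 1 h * of_real (real q powr (- real n / 2))"
    using cancel[of "horocycle q \<phi> (int n)"] by (simp only: X_coeff_1 c_def) simp
  show "of_real (\<phi> n) = X_coeff n q h * of_real (real q powr (- real n / 2))"
  \<comment> \<open>For \<open>q = 1\<close> the factor \<open>q - 1\<close> removes the sum, so the
    transform of \<open>\<phi>\<close> at \<open>n\<close> is \<open>\<phi> n\<close> and the first
    formula is also the second.\<close>
  proof (cases "q = 1")
    case True
    then show ?thesis using H by (simp add: horocycle_def)
  next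
    case False
    then have "q \<ge> 2" using q by simp
    \<comment> \<open>\<open>B n\<close> is the value that \<open>X_coeff n q h\<close> must
      have.\<close>
    define B where "B = (\<lambda>n. complex_of_real (\<phi> n * real q powr (real n / 2)))"
    have B_diff: "B n - B (n + 2) / of_nat q = c (int n) - c (int n + 2)" for n
    proof -
      \<comment> \<open>The weight gains a factor \<open>q\<close> over two steps. Division by
        \<open>q\<close> thus gives \<open>\<phi> n\<close> and \<open>\<phi> (n + 2)\<close> a
        common weight, while the transform at \<open>n + 2\<close> keeps the factor \<open>q\<close>
        from \<open>horocycle_diff\<close>.\<close>
      have powr: "real q powr (real (n + 2) / 2) = real q powr (real n / 2) * real q"
        using q by (simp add: add_divide_distrib powr_add)
      have diff: "\<phi> n - \<phi> (n + 2) = horocycle q \<phi> (int n) - real q * horocycle q \<phi> (int n + 2)"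
        using horocycle_diff[of N \<phi> q n] \<phi>_eq_0 by simp
      have "\<phi> n * real q powr (real n / 2) - \<phi> (n + 2) * real q powr (real (n + 2) / 2) / real q =
          (\<phi> n - \<phi> (n + 2)) * real q powr (real n / 2)"
        unfolding powr using q by (simp add: field_simps)
      also have "\<dots> = horocycle q \<phi> (int n) * real q powr (real n / 2) -
          horocycle q \<phi> (int n + 2) * real q powr (real (n + 2) / 2)"
        unfolding powr diff by (simp add: algebra_simps)
      finally have eq: "\<phi> n * real q powr (real n / 2) -
          \<phi> (n + 2) * real q powr (real (n + 2) / 2) / real q =
        horocycle q \<phi> (int n) * real q powr (real n / 2) -
          horocycle q \<phi> (int n + 2) * real q powr (real (n + 2) / 2)" .
      have "real_of_int \<bar>int n + 2\<bar> = real (n + 2)" "real_of_int \<bar>int n\<bar> = real n" by auto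
      then show ?thesis
        using arg_cong[OF eq, of complex_of_real] unfolding B_def c_def by (simp add: add.commute)
    qed
    have "X_coeff n q h - B n = 0" for n
    proof (rule backward_recurrence_eq_0[where k = 2 and N = N])
      fix n assume "X_coeff (n + 2) q h - B (n + 2) = 0"
      then have "X_coeff (n + 2) q h = B (n + 2)" by simp
      then have "X_coeff n q h - B (n + 2) / of_nat q = B n - B (n + 2) / of_nat q"
        using X_coeff_diff[OF \<open>q \<ge> 2\<close>, of n] B_diff[of n] by metis
      then show "X_coeff n q h - B n = 0" by simp
    qed (auto simp: X_coeff_eq_0[OF \<open>q \<ge> 2\<close>] B_def \<phi>_eq_0)
    then have "X_coeff n q h = B n" by simp
    then show ?thesis using cancel[of "\<phi> n"] by (simp add: B_def)
  qed
qed

(* For q = 1 the points q powr (s - 1/2) all equal 1, so assumption h_spherical only fixes h 2;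
   h_degenerate then states the same relation with z as a free nonzero variable. For q >= 2 it
   is void. *)

theorem theorem5p5:
  fixes V :: "'v set" and E :: "'v rel" and v0 :: 'v and q :: nat
    and f :: "'v \<Rightarrow> real" and h :: "complex \<Rightarrow> complex"
  assumes q_pos: "q \<ge> 1"
    and tree: "regular_tree V E (q + 1)"
    and base_point: "v0 \<in> V"
    and finite_support: "finite {v \<in> V. f v \<noteq> 0}"
    and radial: "\<forall>v1\<in>V. \<forall>v2\<in>V. graph_dist E v1 v0 = graph_dist E v2 v0 \<longrightarrow> f v1 = f v2"
    and h_spherical: "\<forall>s. h (of_nat q powr (s - 1/2) + of_nat q powr (- s + 1/2)) =
      spherical_transform q (radial_part V E v0 f) s"
    and h_degenerate: "q = 1 \<longrightarrow>
      (\<forall>z. z \<noteq> 0 \<longrightarrow> h (z + inverse z) = spherical_series q (radial_part V E v0 f) z)"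
  shows "\<forall>n::nat.
      complex_of_real (horocycle q (radial_part V E v0 f) (int n)) =
        X_coeff n 1 h * of_real (real q powr (- real n / 2)) \<and>
      complex_of_real (radial_part V E v0 f n) =
        X_coeff n q h * of_real (real q powr (- real n / 2))"
proof
  fix n
  interpret regular_tree V E "q + 1" by (fact tree)
  obtain N where N: "\<And>n. n > N \<Longrightarrow> radial_part V E v0 f n = 0"
    using radial_part_eventually_0[OF base_point _ finite_support] q_pos by auto
  have h: "h (z + inverse z) = spherical_series q (radial_part V E v0 f) z" if "z \<noteq> 0" for z
  proof (cases "q = 1")
    case True
    then show ?thesis using h_degenerate that by blast
  next
    case False
    \<comment> \<open>This solves \<open>q powr (s - 1/2) = z\<close>; for \<open>q \<ge> 2\<close>
      the relation in \<open>s\<close> therefore reaches every nonzero \<open>z\<close>.\<close>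
    define s where "s = Ln z / Ln (of_nat q) + 1 / 2"
    have "Ln (of_nat q) \<noteq> (0::complex)"
      using False q_pos by (simp add: Ln_of_nat)
    then have "of_nat q powr (s - 1/2) = z"
      using that q_pos by (simp add: powr_def s_def)
    moreover from this have "of_nat q powr (- s + 1/2) = inverse z"
      by (metis minus_diff_eq powr_minus uminus_add_conv_diff add.commute)
    ultimately show ?thesis
      using h_spherical unfolding spherical_transform_def by metis
  qed
  show "complex_of_real (horocycle q (radial_part V E v0 f) (int n)) =
        X_coeff n 1 h * of_real (real q powr (- real n / 2)) \<and>
      complex_of_real (radial_part V E v0 f n) =
        X_coeff n q h * of_real (real q powr (- real n / 2))"
    using inversion_formula[OF q_pos N h] by blast
qed

end
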